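(* For $i=1,2$, let $V_i\subseteq\mathbb{R}^{X_i}_b$ be a finite dimensional probability inner product $G_i$-space with space of admissible signals $\Phi_i$, and let $T\colon G_1\to G_2$ be a fixed group homomorphism. Let $\mathcal{F}^{\mathrm{all}}$ be the space of all GENEOs from $((\Phi_1,\lVert\cdot\rVert_{V_1}),G_1)$ to $((\Phi_2,\lVert\cdot\rVert_{V_2}),G_2)$ (with respect to $T$). Then for every $\varepsilon>0$ there exists a finite subset $\mathcal{F}\subseteq\mathcal{F}^{\mathrm{all}}$ such that for every $F\in\mathcal{F}^{\mathrm{all}}$ there exists $F'\in\mathcal{F}$ with $\lvert\lvert\lvert F-F'\rvert\rvert\rvert_{L^2}<\varepsilon$.
   Context: Probability inner product $G_i$-space and space of admissible signals ($i=1,2$): $X_i$ is a set, and $V_i$ is a finite dimensional real vector subspace of the space $\mathbb{R}^{X_i}_b$ of all bounded functions $X_i\to\mathbb{R}$. $G_i$ is a subgroup of the group of all bijections of $X_i$; for $g\in G_i$ and $\varphi\in\mathbb{R}^{X_i}_b$ write $\rho_g(\varphi)=\varphi g:=\varphi\circ g$; we assume $\rho_g(V_i)\subseteq V_i$ for all $g\in G_i$. $V_i$ carries an inner product $\langle\cdot,\cdot\rangle_{V_i}$ with $\langle\rho_g(\varphi_1),\rho_g(\varphi_2)\rangle_{V_i}=\langle\varphi_1,\varphi_2\rangle_{V_i}$ for all $g\in G_i$, with norm $\lVert\cdot\rVert_{V_i}$; also $\lVert\varphi\rVert_\infty=\sup_{x\in X_i}|\varphi(x)|$. These two norms are equivalent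 on $V_i$, and Borel sets refer to the common topology. $\mu_{V_i}$ is a Borel probability measure on $V_i$ with $\mu_{V_i}(\rho_g(A))=\mu_{V_i}(A)$ for all Borel $A\subseteq V_i$, $g\in G_i$; its support (the closure of the set of points all of whose open neighborhoods have positive measure) is a compact set denoted $\Phi_i$ (the space of admissible signals). $\nu_{V_i}$ is a finite Borel measure on $V_i$ and $f_{V_i}\colon V_i\to\mathbb{R}$ is a non-negative integrable function such that $\mu_{V_i}(A)=\int_A f_{V_i}\,d\nu_{V_i}$ for every Borel $A\subseteq V_i$; both are $G_i$-invariant: $f_{V_i}(\rho_g(\varphi))=f_{V_i}(\varphi)$ for $\varphi\in\Phi_i$, $g\in G_i$, and $\nu_{V_i}(\rho_g(A))=\nu_{V_i}(A)$ for all Borel $A$, $g\in G_i$. It follows that $\varphi g\in\Phi_i$ for all $\varphi\in\Phi_i$, $g\in G_i$. GEO: a group equivariant operator from $(\Phi_1,G_1)$ to $(\Phi_2,G_2)$ (with respect to $T$) is a square-integrable map $F\colon\Phi_1\to\Phi_2$ (Borel measurable with $\int_{\Phi_1}\lVert F(\varphi)\rVert_{V_2}^2 f_{V_1}(\varphi)\,d\nu_{V_1}<\infty$) satisfying $F(\varphi g)=F(\varphi)T(g)$ for all $\varphi\in\Phi_1$, $g\in G_1$. GENEO: a GENEO from $((\Phi_1,\lVert\cdot\rVert_{V_1}),G_1)$ to $((\Phi_2,\lVert\cdot\rVert_{V_2}),G_2)$ is such a GEO $F$ with $\lVert F(\varphi)-F(\varphi')\rVert_{V_2}\le\lVert\varphi-\varphi'\rVert_{V_1}$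 for all $\varphi,\varphi'\in\Phi_1$. Norm: $\lvert\lvert\lvert F\rvert\rvert\rvert_{L^2}:=\left(\int_{\Phi_1}\lVert F(\varphi)\rVert_{V_2}^2 f_{V_1}(\varphi)\,d\nu_{V_1}\right)^{1/2}$. *)

theory Defs
  imports
    "HOL-Analysis.Analysis"
    "HOL-Algebra.Bij"
    "HOL-Library.Function_Algebras"
    "HOL-Probability.Probability_Measure"
begin

text \<open>Functions into a real vector space form a real vector space pointwise, so that
  \<^const>\<open>subspace\<close> and \<^const>\<open>span\<close> apply to sets of real functions. The additive structure
  comes from \<^theory>\<open>HOL-Library.Function_Algebras\<close>.\<close>

instantiation "fun" :: (type, real_vector) real_vector
begin

definition scaleR_fun_def: "c *\<^sub>R f = (\<lambda>x. c *\<^sub>R f x)"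

instance
  by standard (simp_all add: scaleR_fun_def plus_fun_def fun_eq_iff algebra_simps)

end

section \<open>Probability inner product spaces of signals\<close>

text \<open>A real function on the set \<open>points S\<close> is represented by a function on the whole type that
  vanishes outside \<open>points S\<close>; with this choice the pointwise operations of the type are those of
  functions on \<open>points S\<close>. The elements of \<open>grp S\<close> are bijections of \<open>points S\<close>, extensional as in
  \<^const>\<open>BijGroup\<close>.\<close>

record 'x signal_space =
  points :: "'x set"
  grp :: "('x \<Rightarrow> 'x) set"
  vecs :: "('x \<Rightarrow> real) set"
  ip :: "('x \<Rightarrow> real) \<Rightarrow> ('x \<Rightarrow> real) \<Rightarrow> real"
  prob_meas :: "('x \<Rightarrow> real) measure"
  base_meas :: "('x \<Rightarrow> real) measure"
  dens :: "('x \<Rightarrow> real) \<Rightarrow> real"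

definition bounded_functions :: "'x set \<Rightarrow> ('x \<Rightarrow> real) set" where
  "bounded_functions X = {\<phi>. (\<forall>x. x \<notin> X \<longrightarrow> \<phi> x = 0) \<and> bounded (\<phi> ` X)}"

definition group_of :: "'x signal_space \<Rightarrow> ('x \<Rightarrow> 'x) monoid" where
  "group_of S = BijGroup (points S)\<lparr>carrier := grp S\<rparr>"

text \<open>\<open>act S g \<phi>\<close> is the signal \<open>\<phi> g\<close>, i.e. \<open>\<phi> \<circ> g\<close> on \<open>points S\<close>.\<close>

definition act :: "'x signal_space \<Rightarrow> ('x \<Rightarrow> 'x) \<Rightarrow> ('x \<Rightarrow> real) \<Rightarrow> ('x \<Rightarrow> real)" where
  "act S g \<phi> = (\<lambda>x. if x \<in> points S then \<phi> (g x) else 0)"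

definition vnorm :: "'x signal_space \<Rightarrow> ('x \<Rightarrow> real) \<Rightarrow> real" where
  "vnorm S \<phi> = sqrt (ip S \<phi> \<phi>)"

text \<open>\<^locale>\<open>Metric_space\<close> demands nonnegativity and symmetry of the distance on the whole type,
  hence the value 0 outside \<open>vecs S\<close>, where \<open>ip S\<close> is unconstrained.\<close>

definition vdist :: "'x signal_space \<Rightarrow> ('x \<Rightarrow> real) \<Rightarrow> ('x \<Rightarrow> real) \<Rightarrow> real" where
  "vdist S \<phi> \<psi> = (if \<phi> \<in> vecs S \<and> \<psi> \<in> vecs S then vnorm S (\<phi> - \<psi>) else 0)"

text \<open>The topology is that of the norm of the inner product; as \<open>vecs S\<close> is finite dimensional,
  the supremum norm induces the same one.\<close>

definition vtop :: "'x signal_space \<Rightarrow> ('x \<Rightarrow> real) topology" where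
  "vtop S = Metric_space.mtopology (vecs S) (vdist S)"

definition vborel :: "'x signal_space \<Rightarrow> ('x \<Rightarrow> real) measure" where
  "vborel S = sigma (vecs S) {U. openin (vtop S) U}"

definition admissible :: "'x signal_space \<Rightarrow> ('x \<Rightarrow> real) set" where
  "admissible S = vtop S closure_of
     {\<phi> \<in> vecs S. \<forall>U. openin (vtop S) U \<and> \<phi> \<in> U \<longrightarrow> emeasure (prob_meas S) U > 0}"

locale inner_product_signal_space =
  fixes S :: "'x signal_space"
  assumes vecs_bounded: "vecs S \<subseteq> bounded_functions (points S)"
    and vecs_subspace: "subspace (vecs S)"
    and vecs_finite_dim: "\<exists>B. finite B \<and> vecs S = span B"
    and ip_sym: "\<lbrakk>\<phi> \<in> vecs S; \<psi> \<in> vecs S\<rbrakk> \<Longrightarrow> ip S \<phi> \<psi> = ip S \<psi> \<phi>"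
    and ip_add: "\<lbrakk>\<phi> \<in> vecs S; \<phi>' \<in> vecs S; \<psi> \<in> vecs S\<rbrakk>
           \<Longrightarrow> ip S (\<phi> + \<phi>') \<psi> = ip S \<phi> \<psi> + ip S \<phi>' \<psi>"
    and ip_scale: "\<lbrakk>\<phi> \<in> vecs S; \<psi> \<in> vecs S\<rbrakk> \<Longrightarrow> ip S (c *\<^sub>R \<phi>) \<psi> = c * ip S \<phi> \<psi>"
    and ip_pos: "\<lbrakk>\<phi> \<in> vecs S; \<phi> \<noteq> 0\<rbrakk> \<Longrightarrow> ip S \<phi> \<phi> > 0"

locale prob_inner_product_space = inner_product_signal_space S for S :: "'x signal_space" +
  assumes grp_subgroup: "subgroup (grp S) (BijGroup (points S))"
    and act_closed: "g \<in> grp S \<Longrightarrow> act S g ` vecs S \<subseteq> vecs S"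
    and ip_invariant: "\<lbrakk>g \<in> grp S; \<phi> \<in> vecs S; \<psi> \<in> vecs S\<rbrakk>
           \<Longrightarrow> ip S (act S g \<phi>) (act S g \<psi>) = ip S \<phi> \<psi>"
    and prob_borel: "sets (prob_meas S) = sets (vborel S)"
    and prob_prob: "prob_space (prob_meas S)"
    and prob_invariant: "\<lbrakk>g \<in> grp S; A \<in> sets (vborel S)\<rbrakk>
           \<Longrightarrow> emeasure (prob_meas S) (act S g ` A) = emeasure (prob_meas S) A"
    and admissible_compact: "compactin (vtop S) (admissible S)"
    and base_borel: "sets (base_meas S) = sets (vborel S)"
    and base_finite: "finite_measure (base_meas S)"
    and base_invariant: "\<lbrakk>g \<in> grp S; A \<in> sets (vborel S)\<rbrakk>
           \<Longrightarrow> emeasure (base_meas S) (act S g ` A) = emeasure (base_meas S) A"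
    and dens_nonneg: "\<phi> \<in> vecs S \<Longrightarrow> dens S \<phi> \<ge> 0"
    and dens_integrable: "integrable (base_meas S) (dens S)"
    and prob_density: "A \<in> sets (vborel S)
           \<Longrightarrow> measure (prob_meas S) A = (LINT \<phi>:A|base_meas S. dens S \<phi>)"
    and dens_invariant: "\<lbrakk>g \<in> grp S; \<phi> \<in> admissible S\<rbrakk> \<Longrightarrow> dens S (act S g \<phi>) = dens S \<phi>"

section \<open>Group equivariant operators\<close>

type_synonym ('x, 'y) signal_operator = "('x \<Rightarrow> real) \<Rightarrow> ('y \<Rightarrow> real)"

definition square_integrable ::
  "'x signal_space \<Rightarrow> 'y signal_space \<Rightarrow> ('x, 'y) signal_operator \<Rightarrow> bool" where
  "square_integrable S1 S2 F \<longleftrightarrow>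
     F \<in> restrict_space (vborel S1) (admissible S1) \<rightarrow>\<^sub>M restrict_space (vborel S2) (admissible S2) \<and>
     (\<integral>\<^sup>+\<phi>\<in>admissible S1. ennreal ((vnorm S2 (F \<phi>))\<^sup>2 * dens S1 \<phi>) \<partial>base_meas S1) < \<infinity>"

text \<open>Operators are extensional on \<open>admissible S1\<close>, so that each map between the spaces of
  admissible signals has exactly one representative.\<close>

definition GEO :: "'x signal_space \<Rightarrow> 'y signal_space \<Rightarrow> (('x \<Rightarrow> 'x) \<Rightarrow> ('y \<Rightarrow> 'y))
    \<Rightarrow> ('x, 'y) signal_operator set" where
  "GEO S1 S2 T = {F \<in> admissible S1 \<rightarrow>\<^sub>E admissible S2.
     square_integrable S1 S2 F \<and>
     (\<forall>\<phi>\<in>admissible S1. \<forall>g\<in>grp S1. F (act S1 g \<phi>) = act S2 (T g) (F \<phi>))}"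

definition GENEO :: "'x signal_space \<Rightarrow> 'y signal_space \<Rightarrow> (('x \<Rightarrow> 'x) \<Rightarrow> ('y \<Rightarrow> 'y))
    \<Rightarrow> ('x, 'y) signal_operator set" where
  "GENEO S1 S2 T = {F \<in> GEO S1 S2 T.
     \<forall>\<phi>\<in>admissible S1. \<forall>\<phi>'\<in>admissible S1. vnorm S2 (F \<phi> - F \<phi>') \<le> vnorm S1 (\<phi> - \<phi>')}"

definition L2_op_norm ::
  "'x signal_space \<Rightarrow> 'y signal_space \<Rightarrow> ('x, 'y) signal_operator \<Rightarrow> real" where
  "L2_op_norm S1 S2 F =
     sqrt (LINT \<phi>:admissible S1|base_meas S1. (vnorm S2 (F \<phi>))\<^sup>2 * dens S1 \<phi>)"

section \<open>The distance is a metric\<close>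

context inner_product_signal_space
begin

lemma ip_zero: "ip S 0 0 = 0"
  using ip_scale[of 0 0 0] subspace_0[OF vecs_subspace] by simp

lemma ip_nonneg: "\<phi> \<in> vecs S \<Longrightarrow> 0 \<le> ip S \<phi> \<phi>"
  using ip_pos[of \<phi>] ip_zero by (cases "\<phi> = 0") auto

lemma ip_comb:
  assumes "\<phi> \<in> vecs S" "\<psi> \<in> vecs S"
  shows "ip S (\<phi> + c *\<^sub>R \<psi>) (\<phi> + c *\<^sub>R \<psi>) = ip S \<phi> \<phi> + 2 * c * ip S \<phi> \<psi> + c\<^sup>2 * ip S \<psi> \<psi>"
proof -
  have m: "c *\<^sub>R \<psi> \<in> vecs S" "\<phi> + c *\<^sub>R \<psi> \<in> vecs S"
    using assms vecs_subspace by (auto intro: subspace_scale subspace_add)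
  have "ip S (\<phi> + c *\<^sub>R \<psi>) (\<phi> + c *\<^sub>R \<psi>) = ip S (\<phi> + c *\<^sub>R \<psi>) \<phi> + c * ip S (\<phi> + c *\<^sub>R \<psi>) \<psi>"
    using ip_add[OF assms(1) m(1) m(2)] ip_scale[OF assms(2) m(2), of c]
      ip_sym[OF assms(1) m(2)] ip_sym[OF assms(2) m(2)] by simp
  also have "\<dots> = (ip S \<phi> \<phi> + c * ip S \<psi> \<phi>) + c * (ip S \<phi> \<psi> + c * ip S \<psi> \<psi>)"
    using ip_add[OF assms(1) m(1)] ip_scale[OF assms(2)] assms by simp
  finally show ?thesis
    using ip_sym[OF assms] by (simp add: algebra_simps power2_eq_square)
qed

lemma ip_Cauchy_Schwarz:
  assumes "\<phi> \<in> vecs S" "\<psi> \<in> vecs S"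
  shows "ip S \<phi> \<psi> \<le> vnorm S \<phi> * vnorm S \<psi>"
proof (cases "\<psi> = 0")
  case True
  have "ip S \<phi> 0 = 0"
    using ip_scale[of 0 \<phi> 0] ip_sym[of \<phi> 0] subspace_0[OF vecs_subspace] assms by simp
  then show ?thesis using True ip_zero by (simp add: vnorm_def)
next
  case False
  define a b d where "a = ip S \<phi> \<phi>" and "b = ip S \<phi> \<psi>" and "d = ip S \<psi> \<psi>"
  have d: "d > 0" using False assms ip_pos by (simp add: d_def)
  have "\<phi> + (- b / d) *\<^sub>R \<psi> \<in> vecs S"
    using assms vecs_subspace by (intro subspace_add subspace_scale)
  from ip_nonneg[OF this] have "0 \<le> a + 2 * (- b / d) * b + (- b / d)\<^sup>2 * d"
    unfolding ip_comb[OF assms] a_def b_def d_def .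
  also have "\<dots> = a - b\<^sup>2 / d" using d by (simp add: power2_eq_square field_simps)
  finally have "b\<^sup>2 \<le> a * d" using d by (simp add: field_simps)
  then have "\<bar>b\<bar> \<le> sqrt (a * d)" using real_le_rsqrt[of "\<bar>b\<bar>"] by simp
  then show ?thesis by (simp add: vnorm_def real_sqrt_mult a_def b_def d_def)
qed

lemma vnorm_triangle:
  assumes "\<phi> \<in> vecs S" "\<psi> \<in> vecs S"
  shows "vnorm S (\<phi> + \<psi>) \<le> vnorm S \<phi> + vnorm S \<psi>"
proof -
  have n: "0 \<le> vnorm S \<phi>" "0 \<le> vnorm S \<psi>"
    using assms ip_nonneg by (auto simp: vnorm_def)
  have "ip S (\<phi> + \<psi>) (\<phi> + \<psi>) = (vnorm S \<phi>)\<^sup>2 + 2 * ip S \<phi> \<psi> + (vnorm S \<psi>)\<^sup>2"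
    using ip_comb[OF assms, of 1] assms ip_nonneg by (simp add: vnorm_def)
  also have "\<dots> \<le> (vnorm S \<phi> + vnorm S \<psi>)\<^sup>2"
    using ip_Cauchy_Schwarz[OF assms] by (simp add: power2_sum)
  finally show ?thesis
    using n by (simp add: vnorm_def[of S "\<phi> + \<psi>"] real_le_lsqrt)
qed

lemma Metric_space_vdist: "Metric_space (vecs S) (vdist S)"
proof
  fix \<phi> \<psi>
  show "0 \<le> vdist S \<phi> \<psi>"
    using ip_nonneg subspace_diff[OF vecs_subspace] by (auto simp: vdist_def vnorm_def)
  have "ip S (\<phi> - \<psi>) (\<phi> - \<psi>) = ip S (\<psi> - \<phi>) (\<psi> - \<phi>)" if "\<phi> \<in> vecs S" "\<psi> \<in> vecs S"
    using ip_comb[of 0 "\<phi> - \<psi>" "- 1"] ip_scale[of 0 "\<phi> - \<psi>" 0] that ip_zero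
      subspace_0[OF vecs_subspace] subspace_diff[OF vecs_subspace] by simp
  then show "vdist S \<phi> \<psi> = vdist S \<psi> \<phi>"
    by (auto simp: vdist_def vnorm_def)
  show "vdist S \<phi> \<psi> = 0 \<longleftrightarrow> \<phi> = \<psi>" if "\<phi> \<in> vecs S" "\<psi> \<in> vecs S"
    using that ip_zero ip_pos[of "\<phi> - \<psi>"] subspace_diff[OF vecs_subspace]
    by (cases "\<phi> = \<psi>") (force simp: vdist_def vnorm_def)+
  fix \<eta>
  show "vdist S \<phi> \<eta> \<le> vdist S \<phi> \<psi> + vdist S \<psi> \<eta>"
    if "\<phi> \<in> vecs S" "\<psi> \<in> vecs S" "\<eta> \<in> vecs S"
    using that vnorm_triangle[of "\<phi> - \<psi>" "\<psi> - \<eta>"] subspace_diff[OF vecs_subspace]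
    by (simp add: vdist_def)
qed

end

end

theory Submission
  imports Defs
begin

text \<open>The non-expansive maps between two totally bounded sets form a totally bounded family for
  uniform convergence: such a map is determined up to a small uniform error by its values on a
  finite net of the source, and these values are determined up to a small error by elements of a
  finite net of the target, so that up to a small error only finitely many maps exist
  (\<open>nonexpansive_finite_uniform_net\<close>). The spaces of admissible signals are compact, hence totally
  bounded. As the density of the first space has total mass 1, uniform distance dominates the
  \<open>L\<^sup>2\<close> distance (\<open>L2_op_norm_le_uniform_bound\<close>), so a finite uniform net of GENEOs is also
  a finite net for the \<open>L\<^sup>2\<close> norm.

  A pattern of net values need not itself be the restriction of a GENEO. The finite net
  therefore consists of one GENEO for each of the finitely many patterns that GENEOs realise;
  this is why its members are again GENEOs.\<close>

section \<open>Total boundedness of families of non-expansive maps\<close>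

text \<open>The code of a map \<open>F\<close> sends each point \<open>p\<close> of a finite net of \<open>A\<close> to a point near \<open>F p\<close> of a
  finite net of \<open>B\<close>. There are finitely many codes, and if two maps share a code, then their
  distance at any \<open>x\<close> is at most the sum of four small distances, along the chain from \<open>F x\<close> to
  \<open>F p\<close>, the code at \<open>p\<close>, \<open>F' p\<close> and \<open>F' x\<close>, where \<open>p\<close> is a net point near \<open>x\<close>.\<close>

lemma nonexpansive_finite_uniform_net:
  assumes M1: "Metric_space M1 d1" and M2: "Metric_space M2 d2"
    and A: "Metric_space.mtotally_bounded M1 d1 A"
    and B: "Metric_space.mtotally_bounded M2 d2 B"
    and maps: "\<And>F. F \<in> \<G> \<Longrightarrow> F \<in> A \<rightarrow> B"
    and nonexp: "\<And>F x y. \<lbrakk>F \<in> \<G>; x \<in> A; y \<in> A\<rbrakk> \<Longrightarrow> d2 (F x) (F y) \<le> d1 x y"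
    and "\<epsilon> > 0"
  shows "\<exists>\<F> \<subseteq> \<G>. finite \<F> \<and> (\<forall>F \<in> \<G>. \<exists>F' \<in> \<F>. \<forall>x \<in> A. d2 (F x) (F' x) < \<epsilon>)"
proof -
  interpret M1: Metric_space M1 d1 by (fact M1)
  interpret M2: Metric_space M2 d2 by (fact M2)
  define \<delta> where "\<delta> = \<epsilon> / 4"
  have "\<delta> > 0" using \<open>\<epsilon> > 0\<close> by (simp add: \<delta>_def)
  obtain P where P: "finite P" "P \<subseteq> A" "A \<subseteq> (\<Union>p\<in>P. M1.mball p \<delta>)"
    using A \<open>\<delta> > 0\<close> unfolding M1.mtotally_bounded_def by meson
  obtain Q where Q: "finite Q" "Q \<subseteq> B" "B \<subseteq> (\<Union>q\<in>Q. M2.mball q \<delta>)"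
    using B \<open>\<delta> > 0\<close> unfolding M2.mtotally_bounded_def by meson
  have "\<exists>q\<in>Q. d2 q y < \<delta>" if "y \<in> B" for y
    using subsetD[OF Q(3) that] by auto
  then obtain near where near: "\<And>y. y \<in> B \<Longrightarrow> near y \<in> Q \<and> d2 (near y) y < \<delta>"
    by metis
  define code where "code F = (\<lambda>p\<in>P. near (F p))" for F
  have "code ` \<G> \<subseteq> P \<rightarrow>\<^sub>E Q"
    using maps near P(2) by (fastforce simp: code_def)
  then have "finite (code ` \<G>)"
    using finite_PiE[of P "\<lambda>_. Q"] P(1) Q(1) finite_subset by auto
  then obtain \<F> where \<F>: "\<F> \<subseteq> \<G>" "finite \<F>" "code ` \<G> = code ` \<F>"
    using finite_subset_image[of "code ` \<G>" code \<G>] by auto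
  have "\<exists>F'\<in>\<F>. \<forall>x\<in>A. d2 (F x) (F' x) < \<epsilon>" if F: "F \<in> \<G>" for F
  proof -
    obtain F' where F': "F' \<in> \<F>" "code F = code F'"
      using \<F>(3) F by (metis imageE imageI)
    then have F'G: "F' \<in> \<G>" using \<F>(1) by blast
    have "d2 (F x) (F' x) < \<epsilon>" if x: "x \<in> A" for x
    proof -
      obtain p where p: "p \<in> P" "d1 p x < \<delta>"
        using subsetD[OF P(3) x] by auto
      then have pA: "p \<in> A" using P(2) by blast
      have inB: "F x \<in> B" "F p \<in> B" "F' x \<in> B" "F' p \<in> B"
        using maps[OF F] maps[OF F'G] x pA by auto
      have "B \<subseteq> M2" using B by (rule M2.mtotally_bounded_imp_subset)
      then have inM: "F x \<in> M2" "F p \<in> M2" "F' x \<in> M2" "F' p \<in> M2" "near (F p) \<in> M2"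
        using inB near[OF inB(2)] Q(2) by auto
      have same: "near (F p) = near (F' p)"
        using fun_cong[OF F'(2), of p] p(1) by (simp add: code_def)
      have "d2 (F x) (F p) < \<delta>" "d2 (F' p) (F' x) < \<delta>"
        using nonexp[OF F x pA] nonexp[OF F'G pA x] p(2) M1.commute[of x p] by auto
      moreover have "d2 (F p) (near (F p)) < \<delta>" "d2 (near (F p)) (F' p) < \<delta>"
        using near[OF inB(2)] near[OF inB(4)] same M2.commute by auto
      moreover have "d2 (F x) (F' x) \<le> d2 (F x) (F p) + d2 (F p) (F' x)"
        "d2 (F p) (F' x) \<le> d2 (F p) (near (F p)) + d2 (near (F p)) (F' x)"
        "d2 (near (F p)) (F' x) \<le> d2 (near (F p)) (F' p) + d2 (F' p) (F' x)"
        using inM by (auto intro: M2.triangle)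
      ultimately show ?thesis unfolding \<delta>_def by linarith
    qed
    then show ?thesis using F'(1) by blast
  qed
  then show ?thesis using \<F>(1,2) by blast
qed

section \<open>Uniform bounds dominate the operator norm\<close>

lemma (in inner_product_signal_space) topspace_vtop: "topspace (vtop S) = vecs S"
  unfolding vtop_def by (rule Metric_space.topspace_mtopology[OF Metric_space_vdist])

lemma (in inner_product_signal_space) admissible_subset: "admissible S \<subseteq> vecs S"
  unfolding admissible_def topspace_vtop[symmetric] by (rule closure_of_subset_topspace)

lemma (in inner_product_signal_space) admissible_borel: "admissible S \<in> sets (vborel S)"
proof -
  have sub: "{U. openin (vtop S) U} \<subseteq> Pow (vecs S)"
    using openin_subset topspace_vtop by fastforce
  have "openin (vtop S) (vecs S - admissible S)"
    unfolding admissible_def topspace_vtop[symmetric] by (simp add: openin_diff)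
  then have "vecs S - admissible S \<in> sets (vborel S)"
    unfolding vborel_def by (simp add: sub)
  then have "space (vborel S) - (vecs S - admissible S) \<in> sets (vborel S)"
    by (rule sets.compl_sets)
  moreover have "space (vborel S) - (vecs S - admissible S) = admissible S"
    using admissible_subset by (auto simp: vborel_def space_measure_of[OF sub])
  ultimately show ?thesis by simp
qed

lemma (in prob_inner_product_space) admissible_mtotally_bounded:
  "Metric_space.mtotally_bounded (vecs S) (vdist S) (admissible S)"
  using admissible_compact unfolding vtop_def
  by (rule Metric_space.compactin_imp_mtotally_bounded[OF Metric_space_vdist])

text \<open>The integrand is at most \<open>c\<^sup>2\<close> times the density, whose integral is the probability of a
  set. This covers every \<open>H\<close>, measurable or not: a Bochner integral that does not exist is 0.\<close>

lemma L2_op_norm_le_uniform_bound: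
  assumes S1: "prob_inner_product_space S1" and "c \<ge> 0"
    and bound: "\<And>\<phi>. \<phi> \<in> admissible S1 \<Longrightarrow> \<bar>vnorm S2 (H \<phi>)\<bar> \<le> c"
  shows "L2_op_norm S1 S2 H \<le> c"
proof -
  interpret prob_inner_product_space S1 by (fact S1)
  have adm: "admissible S1 \<in> sets (base_meas S1)"
    using admissible_borel base_borel by simp
  have int: "set_integrable (base_meas S1) (admissible S1) (dens S1)"
    unfolding set_integrable_def
    using dens_integrable adm by (rule integrable_mult_indicator[rotated])
  have le: "(vnorm S2 (H \<phi>))\<^sup>2 * dens S1 \<phi> \<le> c\<^sup>2 * dens S1 \<phi>" and nonneg: "0 \<le> dens S1 \<phi>"
    if "\<phi> \<in> admissible S1" for \<phi>
  proof -
    show dens: "0 \<le> dens S1 \<phi>" using that admissible_subset dens_nonneg by blast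
    have "(vnorm S2 (H \<phi>))\<^sup>2 \<le> c\<^sup>2"
      using bound[OF that] by (simp add: abs_le_square_iff[symmetric] \<open>c \<ge> 0\<close>)
    then show "(vnorm S2 (H \<phi>))\<^sup>2 * dens S1 \<phi> \<le> c\<^sup>2 * dens S1 \<phi>"
      using dens by (rule mult_right_mono)
  qed
  have "(LINT \<phi>:admissible S1|base_meas S1. (vnorm S2 (H \<phi>))\<^sup>2 * dens S1 \<phi>)
      \<le> (LINT \<phi>:admissible S1|base_meas S1. c\<^sup>2 * dens S1 \<phi>)"
    unfolding set_lebesgue_integral_def
  proof (rule integral_mono')
    show "integrable (base_meas S1) (\<lambda>\<phi>. indicator (admissible S1) \<phi> *\<^sub>R (c\<^sup>2 * dens S1 \<phi>))"
      using set_integrable_mult_right[OF int, of "c\<^sup>2"] unfolding set_integrable_def by simp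
  qed (use le nonneg in \<open>auto simp: indicator_def\<close>)
  also have "\<dots> = c\<^sup>2 * measure (prob_meas S1) (admissible S1)"
    using prob_density[OF admissible_borel] by simp
  also have "\<dots> \<le> c\<^sup>2"
    using prob_space.prob_le_1[OF prob_prob] by (simp add: mult_left_le)
  finally show ?thesis
    unfolding L2_op_norm_def using \<open>c \<ge> 0\<close> by (simp add: real_le_lsqrt)
qed

section \<open>Finite nets of GENEOs\<close>

theorem corollary2p22:
  fixes S1 :: "'x signal_space" and S2 :: "'y signal_space"
    and T :: "('x \<Rightarrow> 'x) \<Rightarrow> ('y \<Rightarrow> 'y)" and \<epsilon> :: real
  assumes "prob_inner_product_space S1"
    and "prob_inner_product_space S2"
    and "T \<in> hom (group_of S1) (group_of S2)"
    and "\<epsilon> > 0"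
  shows "\<exists>\<F> \<subseteq> GENEO S1 S2 T. finite \<F> \<and>
           (\<forall>F \<in> GENEO S1 S2 T. \<exists>F' \<in> \<F>. L2_op_norm S1 S2 (F - F') < \<epsilon>)"
proof -
  interpret S1: prob_inner_product_space S1 by (fact assms(1))
  interpret S2: prob_inner_product_space S2 by (fact assms(2))
  have maps: "F \<in> admissible S1 \<rightarrow> admissible S2" if "F \<in> GENEO S1 S2 T" for F
    using that by (auto simp: GENEO_def GEO_def)
  have dist: "vdist S2 (F \<phi>) (F' \<psi>) = vnorm S2 (F \<phi> - F' \<psi>)"
    if "F \<in> GENEO S1 S2 T" "F' \<in> GENEO S1 S2 T" "\<phi> \<in> admissible S1" "\<psi> \<in> admissible S1"
    for F F' \<phi> \<psi>
    using maps[OF that(1)] maps[OF that(2)] that(3,4) S2.admissible_subset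
    by (auto simp: vdist_def)
  have nonexp: "vdist S2 (F \<phi>) (F \<psi>) \<le> vdist S1 \<phi> \<psi>"
    if "F \<in> GENEO S1 S2 T" "\<phi> \<in> admissible S1" "\<psi> \<in> admissible S1" for F \<phi> \<psi>
  proof -
    have "vdist S1 \<phi> \<psi> = vnorm S1 (\<phi> - \<psi>)"
      using that(2,3) S1.admissible_subset by (auto simp: vdist_def)
    then show ?thesis using that dist[OF that(1,1,2,3)] by (simp add: GENEO_def)
  qed
  \<comment> \<open>The uniform bound passes to the operator norm only as a weak inequality; halving \<open>\<epsilon>\<close> keeps
    the final one strict.\<close>
  have "\<exists>\<F> \<subseteq> GENEO S1 S2 T. finite \<F> \<and>
      (\<forall>F \<in> GENEO S1 S2 T. \<exists>F' \<in> \<F>. \<forall>\<phi> \<in> admissible S1. vdist S2 (F \<phi>) (F' \<phi>) < \<epsilon> / 2)"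
    by (rule nonexpansive_finite_uniform_net[OF S1.Metric_space_vdist S2.Metric_space_vdist
          S1.admissible_mtotally_bounded S2.admissible_mtotally_bounded])
      (fact maps nonexp half_gt_zero[OF \<open>\<epsilon> > 0\<close>])+
  then obtain \<F> where \<F>: "\<F> \<subseteq> GENEO S1 S2 T" "finite \<F>"
    and net: "\<And>F. F \<in> GENEO S1 S2 T \<Longrightarrow>
      \<exists>F'\<in>\<F>. \<forall>\<phi>\<in>admissible S1. vdist S2 (F \<phi>) (F' \<phi>) < \<epsilon> / 2"
    by meson
  have "\<exists>F'\<in>\<F>. L2_op_norm S1 S2 (F - F') < \<epsilon>" if F: "F \<in> GENEO S1 S2 T" for F
  proof -
    obtain F' where F': "F' \<in> \<F>"
      and close: "\<And>\<phi>. \<phi> \<in> admissible S1 \<Longrightarrow> vdist S2 (F \<phi>) (F' \<phi>) < \<epsilon> / 2"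
      using net[OF F] by blast
    have "\<bar>vnorm S2 ((F - F') \<phi>)\<bar> \<le> \<epsilon> / 2" if "\<phi> \<in> admissible S1" for \<phi>
    proof -
      have "vnorm S2 ((F - F') \<phi>) = vdist S2 (F \<phi>) (F' \<phi>)"
        using dist[OF F _ that that] F' \<F>(1) by auto
      then show ?thesis
        using close[OF that] Metric_space.nonneg[OF S2.Metric_space_vdist] by simp
    qed
    then have "L2_op_norm S1 S2 (F - F') \<le> \<epsilon> / 2"
      using \<open>\<epsilon> > 0\<close> by (intro L2_op_norm_le_uniform_bound[OF assms(1)]) auto
    then show ?thesis using F' \<open>\<epsilon> > 0\<close> by force
  qed
  then show ?thesis using \<F> by blast
qed

end
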